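(* Let $f(x)=p(x^2)+x\,q(x^2)$, where $f(x),p(x),q(x)\in\mathbb{R}[x]$. The following are equivalent. (A) The polynomial $f$ is stable. (B) The polynomials $p(-x^2)$ and $x\,q(-x^2)$ have simple real interlacing roots, and $\operatorname{Re}\dfrac{p(z_0^2)}{z_0\,q(z_0^2)}>0$ for some $z_0$ with $\operatorname{Re} z_0>0$.
   Context: A polynomial $f$ is called stable if the condition $f(z)=0$ (for $z\in\mathbb{C}$) implies $\operatorname{Re} z<0$. Two polynomials have simple real interlacing roots if all complex roots of each are real and simple, the two have no common root, and strictly between any two consecutive roots of either one there lies exactly one root of the other.
   Formalization: The polynomial f is assumed not to be a nonzero constant; for f = c ≠ 0 (p = c, q = 0), (A) holds vacuously while (B) fails because x q(-x²) is the zero polynomial. *)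

theory Defs
  imports "HOL-Computational_Algebra.Computational_Algebra"
begin

abbreviation cpoly :: "real poly \<Rightarrow> complex poly" where
  "cpoly \<equiv> map_poly complex_of_real"

definition stable_poly :: "complex poly \<Rightarrow> bool" where
  "stable_poly f \<longleftrightarrow> (\<forall>z. poly f z = 0 \<longrightarrow> Re z < 0)"

text \<open>The zero polynomial is excluded here, since \<^term>\<open>\<i>\<close> is one of its roots.\<close>

definition simple_real_roots :: "real poly \<Rightarrow> bool" where
  "simple_real_roots p \<longleftrightarrow>
     (\<forall>z. poly (cpoly p) z = 0 \<longrightarrow> z \<in> \<real> \<and> order z (cpoly p) = 1)"

definition consecutive_roots :: "real poly \<Rightarrow> real \<Rightarrow> real \<Rightarrow> bool" where
  "consecutive_roots p a b \<longleftrightarrow>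
     a < b \<and> poly p a = 0 \<and> poly p b = 0 \<and> (\<forall>c. a < c \<and> c < b \<longrightarrow> poly p c \<noteq> 0)"

definition simple_real_interlacing_roots :: "real poly \<Rightarrow> real poly \<Rightarrow> bool" where
  "simple_real_interlacing_roots p q \<longleftrightarrow>
     simple_real_roots p \<and> simple_real_roots q \<and>
     (\<nexists>z. poly (cpoly p) z = 0 \<and> poly (cpoly q) z = 0) \<and>
     (\<forall>a b. consecutive_roots p a b \<longrightarrow> (\<exists>!c. a < c \<and> c < b \<and> poly q c = 0)) \<and>
     (\<forall>a b. consecutive_roots q a b \<longrightarrow> (\<exists>!c. a < c \<and> c < b \<and> poly p c = 0))"

end

theory Submission
  imports Defs
begin

text \<open>
Put \<open>P(x) = p(-x\<^sup>2)\<close> and \<open>Q(x) = x q(-x\<^sup>2)\<close>. Then \<open>f(\<i> x) = P(x) + \<i> Q(x)\<close>, so stability of \<open>f\<close>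
says that all roots of \<open>G = P + \<i> Q\<close> lie in the open upper half plane. This makes the
theorem an instance of the Hermite--Biehler theorem for two real polynomials \<open>P\<close> and \<open>Q\<close>.
The link between the two sides is the sign of \<open>Im (P(z) cnj (Q(z)))\<close>, which is the sign of
\<open>Im (P(z) / Q(z))\<close> but stays meaningful where \<open>Q\<close> vanishes. Because
\<open>4 Im (P cnj Q) = \<bar>P + \<i> Q\<bar>\<^sup>2 - \<bar>P - \<i> Q\<bar>\<^sup>2\<close> and \<open>\<bar>P(z) - \<i> Q(z)\<bar> = \<bar>G(cnj z)\<bar>\<close>, this sign compares
\<open>\<bar>G\<bar>\<close> at the two points \<open>z\<close> and \<open>cnj z\<close>. Under the rotation \<open>z\<^sub>0 = \<i> z\<close>, its positivity at one
point of the lower half plane is exactly the condition on \<open>z\<^sub>0\<close>.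

Suppose that the roots of \<open>G\<close> lie in the upper half plane. A point \<open>z\<close> of the lower half plane is
further from each of them than \<open>cnj z\<close> is, so \<open>Im (P cnj Q) > 0\<close> throughout the lower half plane;
in particular \<open>P\<close> and \<open>Q\<close> have only real roots. On the real line, each linear factor of \<open>G\<close>
contributes a positive amount to the imaginary part of \<open>G' / G\<close>, and this imaginary part is
\<open>(P Q' - P' Q) / \<bar>G\<bar>\<^sup>2\<close>. Hence the Wronskian has no real zero. This gives simplicity of the roots, and
Rolle's theorem applied to \<open>P / Q\<close> and \<open>Q / P\<close> gives interlacing
(\<open>interlacing_of_roots_upper_half_plane\<close>).

Conversely, suppose that \<open>P\<close> and \<open>Q\<close> interlace and, say, \<open>deg P \<le> deg Q\<close>. Then
\<open>P / Q\<close> is a real constant plus \<open>\<Sum> r\<^sub>x / (z - x)\<close> over the roots \<open>x\<close> of \<open>Q\<close>, with residues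
\<open>r\<^sub>x = P(x) / Q'(x)\<close>. Between consecutive roots of \<open>Q\<close> both \<open>P\<close> and \<open>Q'\<close> change sign, so all
residues have the same sign, and \<open>Im (P cnj Q)\<close> has one constant sign in the lower half plane
(\<open>Im_quotient_constant_sign\<close>). One point decides which sign it is. When it is positive,
\<open>\<bar>P + \<i> Q\<bar> > \<bar>P - \<i> Q\<bar>\<close> excludes roots of \<open>G\<close> in the lower half plane, and a real root of \<open>G\<close> would
be a common root of \<open>P\<close> and \<open>Q\<close> (\<open>roots_upper_half_plane_of_interlacing\<close>).
\<close>

section \<open>Real polynomials over the complex numbers\<close>

lemma poly_cpoly_of_real: "poly (cpoly p) (of_real x) = of_real (poly p x)"
  by (induction p) (auto simp: map_poly_pCons)

lemma poly_cpoly_cnj: "poly (cpoly p) (cnj z) = cnj (poly (cpoly p) z)"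
  by (rule poly_cnj_real[symmetric]) (auto simp: coeff_map_poly)

lemma poly_cpoly_pcompose:
  "poly (cpoly (p \<circ>\<^sub>p q)) z = poly (cpoly p) (poly (cpoly q) z)"
proof -
  have mult: "cpoly (a * b) = cpoly a * cpoly b" for a b
    by (rule poly_eqI) (simp add: coeff_map_poly coeff_mult)
  have add: "cpoly (a + b) = cpoly a + cpoly b" for a b
    by (rule poly_eqI) (simp add: coeff_map_poly)
  show ?thesis
    by (induction p) (simp_all add: pcompose_pCons map_poly_pCons mult add)
qed

lemma poly_cpoly_add: "poly (cpoly (p + q)) z = poly (cpoly p) z + poly (cpoly q) z"
proof -
  have "cpoly (p + q) = cpoly p + cpoly q"
    by (rule poly_eqI) (simp add: coeff_map_poly)
  then show ?thesis by simp
qed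

lemma poly_cpoly_mult: "poly (cpoly (p * q)) z = poly (cpoly p) z * poly (cpoly q) z"
proof -
  have "cpoly (p * q) = cpoly p * cpoly q"
    by (rule poly_eqI) (simp add: coeff_map_poly coeff_mult)
  then show ?thesis by simp
qed

lemma pderiv_cpoly: "pderiv (cpoly p) = cpoly (pderiv p)"
  by (rule poly_eqI) (simp add: coeff_pderiv coeff_map_poly)

lemma degree_cpoly: "degree (cpoly p) = degree p"
  by (rule degree_map_poly) auto

text \<open>
The zero polynomial is not square-free, and on the left it is excluded only because it vanishes at
the non-real point \<open>\<i>\<close>.
\<close>

lemma simple_real_roots_iff:
  "simple_real_roots p \<longleftrightarrow> rsquarefree (cpoly p) \<and> (\<forall>z :: complex. poly (cpoly p) z = 0 \<longrightarrow> z \<in> \<real>)"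
proof
  assume *: "simple_real_roots p"
  have "\<i> \<notin> \<real>"
    by (simp add: complex_is_Real_iff)
  then have "cpoly p \<noteq> 0"
    using * unfolding simple_real_roots_def by (metis poly_0)
  then show "rsquarefree (cpoly p) \<and> (\<forall>z :: complex. poly (cpoly p) z = 0 \<longrightarrow> z \<in> \<real>)"
    using * unfolding simple_real_roots_def rsquarefree_def by (metis order_root)
next
  assume "rsquarefree (cpoly p) \<and> (\<forall>z :: complex. poly (cpoly p) z = 0 \<longrightarrow> z \<in> \<real>)"
  then show "simple_real_roots p"
    unfolding simple_real_roots_def
    using rsquarefree_root_order rsquarefree_def by blast
qed

lemma simple_real_roots_pderiv_nonzero:
  assumes "simple_real_roots p" "poly p x = 0"
  shows "poly (pderiv p) x \<noteq> 0"
proof -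
  have "rsquarefree (cpoly p)" "poly (cpoly p) (of_real x) = 0"
    using assms by (simp_all add: simple_real_roots_iff poly_cpoly_of_real)
  then have "poly (pderiv (cpoly p)) (of_real x) \<noteq> 0"
    unfolding rsquarefree_roots by blast
  then show ?thesis
    by (simp add: pderiv_cpoly poly_cpoly_of_real)
qed

lemma poly_pderiv_linear_factor_mult:
  fixes h :: "'a :: idom poly"
  shows "poly (pderiv ([:-a, 1:] * h)) x = poly h x + (x - a) * poly (pderiv h) x"
  by (simp only: pderiv_mult) (simp add: pderiv_pCons algebra_simps)

section \<open>Products of linear factors with roots in the upper half plane\<close>

text \<open>
Reflecting a point of the lower half plane in the real axis brings it closer to every point of the
upper half plane; the moduli of the linear factors are these distances.
\<close>

lemma cmod_linear_factors_reflect: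
  assumes "\<forall>r\<in>#A. Im r > 0" "Im z < 0" "A \<noteq> {#}"
  shows "cmod (poly (\<Prod>r\<in>#A. [:-r, 1:]) (cnj z)) < cmod (poly (\<Prod>r\<in>#A. [:-r, 1:]) z)"
  using assms
proof (induction A)
  case (add r A)
  define H where "H = (\<Prod>r\<in>#A. [:-r, 1:])"
  have "(cmod (cnj z - r))\<^sup>2 < (cmod (z - r))\<^sup>2"
  proof -
    have "Im r * Im z < 0"
      using add.prems by (simp add: mult_pos_neg)
    then show ?thesis
      by (simp add: cmod_power2) (simp add: power2_eq_square algebra_simps)
  qed
  then have 1: "cmod (cnj z - r) < cmod (z - r)"
    by (rule power_less_imp_less_base) simp
  have 2: "cmod (poly H (cnj z)) \<le> cmod (poly H z)"
    using add unfolding H_def by (cases "A = {#}") (auto simp: less_imp_le)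
  have "poly H z \<noteq> 0"
    using add.prems by (auto simp: H_def poly_prod_mset)
  then have "cmod (cnj z - r) * cmod (poly H (cnj z)) < cmod (z - r) * cmod (poly H z)"
    using 1 2 by (intro le_less_trans[OF mult_left_mono[OF 2]] mult_strict_right_mono) auto
  then have "cmod ((cnj z - r) * poly H (cnj z)) < cmod ((z - r) * poly H z)"
    by (simp add: norm_mult)
  then show ?case
    by (simp add: H_def[symmetric] algebra_simps)
qed simp

text \<open>
The logarithmic derivative of the product is \<open>\<Sum> 1 / (x - r)\<close>, and at a real \<open>x\<close> each summand has
imaginary part \<open>Im r / \<bar>x - r\<bar>\<^sup>2 > 0\<close>. Multiplying it by \<open>\<bar>G(x)\<bar>\<^sup>2\<close> turns \<open>G' / G\<close> into \<open>G' cnj G\<close>, for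
which the induction on the factors needs no division.
\<close>

lemma Im_pderiv_linear_factors_pos:
  fixes x :: real
  assumes "\<forall>r\<in>#A. Im r > 0" "A \<noteq> {#}"
  defines "G \<equiv> \<lambda>A. \<Prod>r\<in>#A. [:-r, 1:]"
  shows "Im (poly (pderiv (G A)) (of_real x) * cnj (poly (G A) (of_real x))) > 0"
  using assms(1,2)
proof (induction A)
  case (add r A)
  define H where "H = poly (G A) (of_real x)"
  define H' where "H' = poly (pderiv (G A)) (of_real x)"
  have GA: "G (add_mset r A) = [:-r, 1:] * G A"
    by (simp add: G_def)
  have "H \<noteq> 0"
    using add.prems by (force simp: G_def H_def poly_prod_mset)
  have "Im (H' * cnj H) \<ge> 0"
    using add unfolding H_def H'_def by (cases "A = {#}") (auto simp: G_def)
  then have "(cmod (x - r))\<^sup>2 * Im (H' * cnj H) \<ge> 0"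
    by simp
  moreover have "(cmod H)\<^sup>2 * Im r > 0"
    using add.prems \<open>H \<noteq> 0\<close> by simp
  moreover have "poly (pderiv (G (add_mset r A))) (of_real x) = H + (x - r) * H'"
    "poly (G (add_mset r A)) (of_real x) = (x - r) * H"
    unfolding GA poly_pderiv_linear_factor_mult by (simp_all add: H_def H'_def algebra_simps)
  moreover have "Im ((H + (x - r) * H') * cnj ((x - r) * H))
      = (cmod H)\<^sup>2 * Im r + (cmod (x - r))\<^sup>2 * Im (H' * cnj H)"
    by (simp add: cmod_power2) algebra
  ultimately show ?case
    by simp
qed simp

section \<open>Nonvanishing Wronskian and interlacing\<close>

text \<open>
If \<open>q\<close> had no root in between, \<open>p / q\<close> would be differentiable on the whole interval and vanish at
both ends; by Rolle's theorem its derivative, whose numerator is the Wronskian up to sign, would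
vanish somewhere.
\<close>

lemma poly_root_between_of_Wronskian_nonzero:
  fixes p q :: "real poly"
  assumes W: "\<And>x. poly p x * poly (pderiv q) x \<noteq> poly (pderiv p) x * poly q x"
    and ab: "a < b" "poly p a = 0" "poly p b = 0"
  shows "\<exists>c. a < c \<and> c < b \<and> poly q c = 0"
proof (rule ccontr)
  assume no_root: "\<nexists>c. a < c \<and> c < b \<and> poly q c = 0"
  have "poly q a \<noteq> 0" "poly q b \<noteq> 0"
    using W[of a] W[of b] ab by auto
  then have q: "poly q x \<noteq> 0" if "a \<le> x" "x \<le> b" for x
    using that no_root by (cases "x = a \<or> x = b") auto
  define h where "h = (\<lambda>x. poly p x / poly q x)"
  have h: "(h has_field_derivative
      (poly (pderiv p) x * poly q x - poly p x * poly (pderiv q) x) / (poly q x * poly q x)) (at x)"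
    if "a \<le> x" "x \<le> b" for x
    unfolding h_def using q[OF that] by (intro DERIV_divide poly_DERIV)
  have "\<exists>x. a < x \<and> x < b \<and> (h has_field_derivative 0) (at x)"
  proof (rule Rolle)
    show "continuous_on {a..b} h"
      unfolding h_def using q by (intro continuous_intros) auto
    show "h differentiable at x" if "a < x" "x < b" for x
      using h[of x] that real_differentiable_def by auto
  qed (use ab in \<open>auto simp: h_def\<close>)
  then obtain x where x: "a < x" "x < b" "(h has_field_derivative 0) (at x)"
    by blast
  then have "(poly (pderiv p) x * poly q x - poly p x * poly (pderiv q) x) / (poly q x * poly q x) = 0"
    using h[of x] DERIV_unique by fastforce
  then show False
    using W[of x] q[of x] x by simp
qed

section \<open>Partial fractions over simple roots\<close>

lemma card_roots_rsquarefree: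
  fixes p :: "complex poly"
  assumes "rsquarefree p"
  shows "card {z. poly p z = 0} = degree p"
proof -
  have "p \<noteq> 0"
    using assms by (simp add: rsquarefree_def)
  then have "degree (smult (lead_coeff p) (\<Prod>z|poly p z = 0. [:-z, 1:])) = card {z. poly p z = 0}"
    by (simp add: degree_prod_sum_eq)
  then show ?thesis
    by (simp add: complex_poly_decompose_rsquarefree[OF assms])
qed

text \<open>
This is Lagrange interpolation at the roots of \<open>D\<close>: with \<open>C\<^sub>x = D / (X - x)\<close>, the polynomial
\<open>\<Sum> N(x) / D'(x) C\<^sub>x\<close> agrees with \<open>N\<close> at all the roots of \<open>D\<close>, because \<open>C\<^sub>x\<close> vanishes at the other roots
and equals \<open>D'(x)\<close> at \<open>x\<close>. Both have degree below the number of these roots, so they coincide.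
\<close>

lemma partial_fractions_simple_roots:
  fixes N D :: "complex poly"
  assumes D: "rsquarefree D" and deg: "degree N < degree D" and z: "poly D z \<noteq> 0"
  shows "poly N z / poly D z
    = (\<Sum>x | poly D x = 0. poly N x / poly (pderiv D) x / (z - x))"
proof -
  define S where "S = {x. poly D x = 0}"
  have "D \<noteq> 0"
    using D by (simp add: rsquarefree_def)
  then have "finite S"
    unfolding S_def by (rule poly_roots_finite)
  define C where "C x = D div [:-x, 1:]" for x
  have C: "D = [:-x, 1:] * C x" if "x \<in> S" for x
    using that unfolding S_def C_def by (metis poly_eq_0_iff_dvd dvd_mult_div_cancel mem_Collect_eq)
  have C_self: "poly (pderiv D) x = poly (C x) x" if "x \<in> S" for x
    by (subst C[OF that]) (simp only: poly_pderiv_linear_factor_mult, simp)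
  have C_off: "poly (C x) y = 0" if "x \<in> S" "y \<in> S" "y \<noteq> x" for x y
  proof -
    have "poly D y = (y - x) * poly (C x) y"
      by (subst C[OF \<open>x \<in> S\<close>]) (simp add: algebra_simps)
    then show ?thesis
      using that by (simp add: S_def)
  qed
  have deg_C: "degree (C x) < degree D" if "x \<in> S" for x
  proof -
    have "C x \<noteq> 0"
      using C[OF that] \<open>D \<noteq> 0\<close> by auto
    then have "degree D = Suc (degree (C x))"
      by (subst C[OF that], subst degree_mult_eq) auto
    then show ?thesis by simp
  qed
  have pderiv_nz: "poly (pderiv D) x \<noteq> 0" if "x \<in> S" for x
    using D that unfolding rsquarefree_roots S_def by blast
  define L where "L = (\<Sum>x\<in>S. smult (poly N x / poly (pderiv D) x) (C x))"
  have "poly (N - L) y = 0" if "y \<in> S" for y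
  proof -
    have "poly L y = (\<Sum>x\<in>S. if x = y then poly N y else 0)"
      unfolding L_def poly_sum
      by (intro sum.cong) (use C_off that C_self pderiv_nz in \<open>auto\<close>)
    then show ?thesis
      using \<open>finite S\<close> that by simp
  qed
  then have sub: "S \<subseteq> {y. poly (N - L) y = 0}"
    by blast
  have "degree L < degree D"
    unfolding L_def using deg_C deg
    by (intro degree_sum_less) (auto intro: le_less_trans[OF degree_smult_le])
  then have "degree (N - L) < card S"
    using deg card_roots_rsquarefree[OF D] unfolding S_def
    by (simp add: degree_diff_less)
  have "N - L = 0"
  proof (rule ccontr)
    assume *: "N - L \<noteq> 0"
    then have "card S \<le> card {y. poly (N - L) y = 0}"
      using sub by (intro card_mono poly_roots_finite)
    also have "\<dots> \<le> degree (N - L)"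
      using * by (rule card_poly_roots_bound)
    finally show False
      using \<open>degree (N - L) < card S\<close> by simp
  qed
  then have "N = L"
    by simp
  then have "poly N z = poly L z"
    by (rule arg_cong)
  then have "poly N z / poly D z = (\<Sum>x\<in>S. poly N x / poly (pderiv D) x * poly (C x) z / poly D z)"
    by (simp add: L_def poly_sum sum_divide_distrib)
  also have "\<dots> = (\<Sum>x\<in>S. poly N x / poly (pderiv D) x / (z - x))"
  proof (intro sum.cong refl)
    fix x assume "x \<in> S"
    have "poly D z = (z - x) * poly (C x) z"
      by (subst C[OF \<open>x \<in> S\<close>]) (simp add: algebra_simps)
    then show "poly N x / poly (pderiv D) x * poly (C x) z / poly D z = poly N x / poly (pderiv D) x / (z - x)"
      using z by simp
  qed
  finally show ?thesis
    unfolding S_def .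
qed

section \<open>Signs at consecutive roots\<close>

text \<open>
Same sign is transitive, so agreement between neighbours spreads to all pairs; the induction is on
the number of elements of \<open>S\<close> that separate \<open>a\<close> from \<open>b\<close>.
\<close>

lemma same_sign_of_consecutive:
  fixes g :: "real \<Rightarrow> real"
  assumes "finite S"
    and step: "\<And>a b. a \<in> S \<Longrightarrow> b \<in> S \<Longrightarrow> a < b \<Longrightarrow> (\<And>c. a < c \<Longrightarrow> c < b \<Longrightarrow> c \<notin> S) \<Longrightarrow> g a * g b > 0"
    and "a \<in> S" "b \<in> S" "a < b"
  shows "g a * g b > 0"
  using assms(3-)
proof (induction "card {c\<in>S. a < c \<and> c < b}" arbitrary: a b rule: less_induct)
  case less
  show ?case
  proof (cases "\<exists>c\<in>S. a < c \<and> c < b")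
    case False
    with less.prems show ?thesis by (intro step) auto
  next
    case True
    then obtain c where c: "c \<in> S" "a < c" "c < b" by blast
    have "{x\<in>S. a < x \<and> x < c} \<subset> {x\<in>S. a < x \<and> x < b}"
      using c by force
    then have 1: "g a * g c > 0"
      using less c \<open>finite S\<close> by (simp add: psubset_card_mono)
    have "{x\<in>S. c < x \<and> x < b} \<subset> {x\<in>S. a < x \<and> x < b}"
      using c by force
    then have 2: "g c * g b > 0"
      using less c \<open>finite S\<close> by (simp add: psubset_card_mono)
    from 1 2 show ?thesis
      by (auto simp: zero_less_mult_iff)
  qed
qed

lemma poly_same_sign_of_no_root:
  fixes p :: "real poly"
  assumes "a < b" "\<And>c. a \<le> c \<Longrightarrow> c \<le> b \<Longrightarrow> poly p c \<noteq> 0"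
  shows "poly p a * poly p b > 0"
proof -
  have "poly p a * poly p b \<noteq> 0" "\<not> poly p a * poly p b < 0"
    using assms poly_IVT[of a b p] by (auto simp: less_imp_le)
  then show ?thesis by linarith
qed

text \<open>
Write \<open>p = (x - a) (x - b) e\<close>. By simplicity \<open>e\<close> has no root in \<open>[a, b]\<close>, so it keeps its sign, while
\<open>p'(a) = (a - b) e(a)\<close> and \<open>p'(b) = (b - a) e(b)\<close>.
\<close>

lemma pderiv_opposite_signs_at_consecutive_roots:
  assumes "simple_real_roots p" "consecutive_roots p a b"
  shows "poly (pderiv p) a * poly (pderiv p) b < 0"
proof -
  have ab: "a < b" "poly p a = 0" "poly p b = 0"
    and no_root: "\<And>c. a < c \<Longrightarrow> c < b \<Longrightarrow> poly p c \<noteq> 0"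
    using assms(2) by (auto simp: consecutive_roots_def)
  obtain r where r: "p = [:-a, 1:] * r"
    using ab by (metis poly_eq_0_iff_dvd dvd_def)
  then have "poly r b = 0"
    using ab by auto
  then obtain e where "r = [:-b, 1:] * e"
    by (metis poly_eq_0_iff_dvd dvd_def)
  with r have p: "p = [:-a, 1:] * ([:-b, 1:] * e)" by simp
  have d: "poly (pderiv p) a = (a - b) * poly e a" "poly (pderiv p) b = (b - a) * poly e b"
    unfolding p poly_pderiv_linear_factor_mult by (simp_all add: algebra_simps)
  have "poly e a \<noteq> 0" "poly e b \<noteq> 0"
    using simple_real_roots_pderiv_nonzero[OF assms(1)] ab d by auto
  moreover have "poly e c \<noteq> 0" if "a < c" "c < b" for c
    using no_root[OF that] p by auto
  ultimately have "poly e a * poly e b > 0"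
    using ab by (intro poly_same_sign_of_no_root) (auto simp: le_less)
  then have "(b - a)\<^sup>2 * (poly e a * poly e b) > 0"
    using ab by simp
  moreover have "poly (pderiv p) a * poly (pderiv p) b = - ((b - a)\<^sup>2 * (poly e a * poly e b))"
    unfolding d by (simp add: power2_eq_square algebra_simps)
  ultimately show ?thesis by simp
qed

text \<open>
The cofactor of the linear factor at the root keeps its sign on \<open>[a, b]\<close>, as the root is simple and the only one;
the linear factor changes its sign.
\<close>

lemma poly_opposite_signs_around_unique_root:
  assumes "simple_real_roots p" "\<exists>!c. a < c \<and> c < b \<and> poly p c = 0"
    "poly p a \<noteq> 0" "poly p b \<noteq> 0"
  shows "poly p a * poly p b < 0"
proof -
  obtain c where c: "a < c" "c < b" "poly p c = 0"
    and unique: "\<And>d. a < d \<Longrightarrow> d < b \<Longrightarrow> poly p d = 0 \<Longrightarrow> d = c"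
    using assms(2) by blast
  obtain h where p: "p = [:-c, 1:] * h"
    using c by (metis poly_eq_0_iff_dvd dvd_def)
  have p_eval: "poly p x = (x - c) * poly h x" for x
    unfolding p by (simp add: algebra_simps)
  have "poly (pderiv p) c = poly h c"
    unfolding p poly_pderiv_linear_factor_mult by simp
  then have "poly h c \<noteq> 0"
    using simple_real_roots_pderiv_nonzero[OF assms(1)] c by auto
  then have "poly h d \<noteq> 0" if "a < d" "d < b" for d
    using unique[OF that] p_eval[of d] by (metis mult_zero_right)
  moreover have "poly h a \<noteq> 0" "poly h b \<noteq> 0"
    using assms(3,4) by (simp_all add: p_eval)
  ultimately have "poly h a * poly h b > 0"
    using c by (intro poly_same_sign_of_no_root) (auto simp: le_less)
  moreover have "(c - a) * (b - c) > 0"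
    using c by simp
  ultimately have "((c - a) * (b - c)) * (poly h a * poly h b) > 0"
    by (rule mult_pos_pos[rotated])
  moreover have "poly p a * poly p b = - (((c - a) * (b - c)) * (poly h a * poly h b))"
    unfolding p_eval by (simp add: algebra_simps)
  ultimately show ?thesis by simp
qed

section \<open>The Hermite--Biehler theorem\<close>

text \<open>
For \<open>a = P(z)\<close> and \<open>b = Q(z)\<close> the right-hand side compares the moduli of \<open>P + \<i> Q\<close> at \<open>z\<close> and at \<open>cnj z\<close>.
\<close>

lemma Im_mult_cnj_eq:
  "4 * Im (a * cnj b) = (cmod (a + \<i> * b))\<^sup>2 - (cmod (a - \<i> * b))\<^sup>2"
  by (simp add: cmod_power2) algebra

lemma simple_real_interlacing_roots_sym:
  "simple_real_interlacing_roots P Q \<longleftrightarrow> simple_real_interlacing_roots Q P"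
  unfolding simple_real_interlacing_roots_def by blast

lemma no_common_real_root:
  assumes "simple_real_interlacing_roots P Q" "poly Q x = 0"
  shows "poly P x \<noteq> 0"
  using assms unfolding simple_real_interlacing_roots_def
  by (metis of_real_0 poly_cpoly_of_real)

text \<open>
The residue of \<open>P / Q\<close> at a simple root \<open>x\<close> of \<open>Q\<close> is \<open>P(x) / Q'(x)\<close>, which has the sign of
\<open>P(x) Q'(x)\<close>. From one root of \<open>Q\<close> to the next, \<open>P\<close> changes its sign by interlacing and \<open>Q'\<close> does so
by simplicity, so the product keeps its sign.
\<close>

lemma residue_signs_agree:
  assumes PQ: "simple_real_interlacing_roots P Q"
    and roots: "poly Q a = 0" "poly Q b = 0"
  shows "poly P a * poly (pderiv Q) a * (poly P b * poly (pderiv Q) b) > 0"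
proof -
  define g where "g = (\<lambda>x. poly P x * poly (pderiv Q) x)"
  define S where "S = {x. poly Q x = 0}"
  have P: "simple_real_roots P" and Q: "simple_real_roots Q"
    using PQ by (auto simp: simple_real_interlacing_roots_def)
  then have "Q \<noteq> 0"
    unfolding simple_real_roots_iff rsquarefree_def by auto
  then have "finite S"
    unfolding S_def by (rule poly_roots_finite)
  have less: "g a * g b > 0" if "a \<in> S" "b \<in> S" "a < b" for a b
  proof (rule same_sign_of_consecutive[OF \<open>finite S\<close> _ that])
    fix a b
    assume ab: "a \<in> S" "b \<in> S" "a < b" "\<And>c. a < c \<Longrightarrow> c < b \<Longrightarrow> c \<notin> S"
    then have consec: "consecutive_roots Q a b"
      by (simp add: consecutive_roots_def S_def)
    then have "\<exists>!c. a < c \<and> c < b \<and> poly P c = 0"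
      using PQ unfolding simple_real_interlacing_roots_def by blast
    then have "poly P a * poly P b < 0"
      using P PQ ab no_common_real_root
      by (intro poly_opposite_signs_around_unique_root) (auto simp: S_def)
    with pderiv_opposite_signs_at_consecutive_roots[OF Q consec]
    have "(poly P a * poly P b) * (poly (pderiv Q) a * poly (pderiv Q) b) > 0"
      by (rule mult_neg_neg[rotated])
    then show "g a * g b > 0"
      by (simp add: g_def mult_ac)
  qed
  have "g x \<noteq> 0" if "x \<in> S" for x
    using that no_common_real_root[OF PQ] simple_real_roots_pderiv_nonzero[OF Q]
    by (simp add: g_def S_def)
  then have "g a * g b > 0"
    using roots less[of a b] less[of b a]
    by (cases a b rule: linorder_cases) (auto simp: S_def mult.commute zero_less_mult_iff linorder_neq_iff)
  then show ?thesis
    by (simp add: g_def)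
qed

text \<open>
Splitting off the real constant \<open>c\<close> makes the numerator of smaller degree than \<open>Q\<close> without changing
its values at the roots of \<open>Q\<close>. In \<open>P / Q = c + \<Sum> r\<^sub>x / (z - x)\<close> with \<open>r\<^sub>x > 0\<close> every summand
then has positive imaginary part in the lower half plane.
\<close>

lemma Im_quotient_pos_of_residues_pos:
  assumes Q: "simple_real_roots Q" and deg: "degree P \<le> degree Q" "degree Q > 0"
    and pos: "\<And>x. poly Q x = 0 \<Longrightarrow> poly P x * poly (pderiv Q) x > 0"
    and z: "Im z < 0"
  shows "Im (poly (cpoly P) z * cnj (poly (cpoly Q) z)) > 0"
proof -
  define c where "c = coeff P (degree Q) / lead_coeff Q"
  define R where "R = P - smult c Q"
  define S where "S = {x. poly (cpoly Q) x = 0}"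
  have Qsf: "rsquarefree (cpoly Q)" and Qreal: "\<And>x. x \<in> S \<Longrightarrow> x \<in> \<real>"
    using Q by (auto simp: simple_real_roots_iff S_def)
  have "degree R < degree Q"
  proof -
    have "degree R \<le> degree Q"
      unfolding R_def using deg by (intro degree_diff_le) (auto intro: order_trans[OF degree_smult_le])
    moreover have "coeff R (degree Q) = 0"
      using deg by (auto simp: R_def c_def)
    ultimately show ?thesis
      using deg(2) by (metis degree_0 le_less leading_coeff_0_iff)
  qed
  have "z \<notin> \<real>"
    using z by (auto simp: complex_is_Real_iff)
  then have Qz: "poly (cpoly Q) z \<noteq> 0"
    using Qreal by (auto simp: S_def)
  have P: "P = R + smult c Q"
    by (simp add: R_def)
  have Pz: "poly (cpoly P) w = poly (cpoly R) w + of_real c * poly (cpoly Q) w" for w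
    unfolding P by (simp add: poly_cpoly_add map_poly_smult)
  \<comment> \<open>Since \<open>R\<close> and \<open>P\<close> agree at the roots of \<open>Q\<close>, the residues may be written with \<open>P\<close>.\<close>
  define T where "T = (\<lambda>x. poly (cpoly P) x / poly (pderiv (cpoly Q)) x / (z - x))"
  have "poly (cpoly R) z / poly (cpoly Q) z
      = (\<Sum>x\<in>S. poly (cpoly R) x / poly (pderiv (cpoly Q)) x / (z - x))"
    unfolding S_def using \<open>degree R < degree Q\<close> Qsf Qz
    by (intro partial_fractions_simple_roots) (auto simp: degree_cpoly)
  also have "\<dots> = (\<Sum>x\<in>S. T x)"
    by (intro sum.cong) (auto simp: T_def Pz S_def)
  finally have "poly (cpoly P) z = poly (cpoly Q) z * (of_real c + (\<Sum>x\<in>S. T x))"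
    using Qz by (simp add: Pz field_simps)
  then have "poly (cpoly P) z * cnj (poly (cpoly Q) z)
      = of_real ((cmod (poly (cpoly Q) z))\<^sup>2) * (of_real c + (\<Sum>x\<in>S. T x))"
    by (simp add: complex_norm_square mult_ac del: of_real_power)
  then have "Im (poly (cpoly P) z * cnj (poly (cpoly Q) z))
      = (cmod (poly (cpoly Q) z))\<^sup>2 * (\<Sum>x\<in>S. Im (T x))"
    by (simp add: Im_sum del: of_real_power)
  moreover have "(\<Sum>x\<in>S. Im (T x)) > 0"
  proof (rule sum_pos)
    have card: "card S > 0"
      unfolding S_def card_roots_rsquarefree[OF Qsf] using deg by (simp add: degree_cpoly)
    then show "finite S" "S \<noteq> {}"
      by (auto simp: card_gt_0_iff)
    fix x assume "x \<in> S"
    then obtain t where t: "x = of_real t"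
      using Qreal Reals_cases by blast
    then have "poly Q t = 0"
      using \<open>x \<in> S\<close> by (simp add: S_def poly_cpoly_of_real)
    have "poly P t / poly (pderiv Q) t > 0"
      using pos[OF \<open>poly Q t = 0\<close>] by (auto simp: zero_less_mult_iff zero_less_divide_iff)
    moreover have "Im (1 / (z - of_real t)) > 0"
      using z by (simp add: Im_divide divide_neg_pos add_nonneg_pos)
    moreover have "T x = of_real (poly P t / poly (pderiv Q) t) * (1 / (z - of_real t))"
      by (simp add: T_def t pderiv_cpoly poly_cpoly_of_real)
    ultimately show "Im (T x) > 0"
      by (simp only: times_complex.sel Re_complex_of_real Im_complex_of_real mult_zero_left add_0_right mult_pos_pos)
  qed
  ultimately show ?thesis
    using Qz by simp
qed

lemma Im_quotient_constant_sign_of_degree_le: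
  assumes PQ: "simple_real_interlacing_roots P Q" and deg: "degree P \<le> degree Q" "degree Q > 0"
  shows "(\<forall>z. Im z < 0 \<longrightarrow> Im (poly (cpoly P) z * cnj (poly (cpoly Q) z)) > 0) \<or>
         (\<forall>z. Im z < 0 \<longrightarrow> Im (poly (cpoly P) z * cnj (poly (cpoly Q) z)) < 0)"
proof -
  have Q: "simple_real_roots Q"
    using PQ by (simp add: simple_real_interlacing_roots_def)
  consider "\<And>x. poly Q x = 0 \<Longrightarrow> poly P x * poly (pderiv Q) x > 0"
    | "\<And>x. poly Q x = 0 \<Longrightarrow> poly P x * poly (pderiv Q) x < 0"
    using residue_signs_agree[OF PQ] by (metis zero_less_mult_iff)
  then show ?thesis
  proof cases
    case 1
    then show ?thesis
      using Im_quotient_pos_of_residues_pos[OF Q deg] by blast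
  next
    case 2
    have cpoly_minus: "poly (cpoly (- P)) z = - poly (cpoly P) z" for z
      using poly_cpoly_add[of P "- P" z] by (simp add: eq_neg_iff_add_eq_0 add.commute)
    have "Im (poly (cpoly (- P)) z * cnj (poly (cpoly Q) z)) > 0" if "Im z < 0" for z
      using 2 deg that by (intro Im_quotient_pos_of_residues_pos[OF Q]) auto
    then show ?thesis
      by (simp add: cpoly_minus)
  qed
qed

text \<open>
Exchanging \<open>P\<close> and \<open>Q\<close> only negates \<open>Im (P cnj Q)\<close>, so the polynomial of larger degree can be taken
as the denominator.
\<close>

lemma Im_quotient_constant_sign:
  assumes PQ: "simple_real_interlacing_roots P Q" and deg: "degree P > 0 \<or> degree Q > 0"
  shows "(\<forall>z. Im z < 0 \<longrightarrow> Im (poly (cpoly P) z * cnj (poly (cpoly Q) z)) > 0) \<or>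
         (\<forall>z. Im z < 0 \<longrightarrow> Im (poly (cpoly P) z * cnj (poly (cpoly Q) z)) < 0)"
proof (cases "degree P \<le> degree Q")
  case True
  then show ?thesis
    using Im_quotient_constant_sign_of_degree_le[OF PQ] deg by (metis gr0I leD)
next
  case False
  have swap: "Im (poly (cpoly Q) z * cnj (poly (cpoly P) z))
      = - Im (poly (cpoly P) z * cnj (poly (cpoly Q) z))" for z
    by simp
  have "simple_real_interlacing_roots Q P"
    using PQ simple_real_interlacing_roots_sym by blast
  then show ?thesis
    using Im_quotient_constant_sign_of_degree_le[of Q P] False
    unfolding swap by auto
qed

text \<open>
The condition on the Wronskian is symmetric in \<open>P\<close> and \<open>Q\<close>. It forbids double roots and common
roots. Rolle's theorem puts a root of each polynomial between any two roots of the other, and used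
twice it gives uniqueness: two roots of \<open>Q\<close> between consecutive roots of \<open>P\<close> would enclose a
further root of \<open>P\<close>.
\<close>

lemma interlacing_of_Wronskian_nonzero:
  fixes P Q :: "real poly"
  assumes real: "\<And>z :: complex. poly (cpoly P) z = 0 \<Longrightarrow> z \<in> \<real>" "\<And>z :: complex. poly (cpoly Q) z = 0 \<Longrightarrow> z \<in> \<real>"
    and W: "\<And>x. poly P x * poly (pderiv Q) x \<noteq> poly (pderiv P) x * poly Q x"
  shows "simple_real_interlacing_roots P Q"
proof -
  have W': "poly Q x * poly (pderiv P) x \<noteq> poly (pderiv Q) x * poly P x" for x
    using W[of x] by (simp add: mult.commute)
  have simple: "simple_real_roots A"
    if realA: "\<And>z :: complex. poly (cpoly A) z = 0 \<Longrightarrow> z \<in> \<real>"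
      and WA: "\<And>x. poly A x * poly (pderiv B) x \<noteq> poly (pderiv A) x * poly B x" for A B
  proof -
    have "\<not> (poly (cpoly A) z = 0 \<and> poly (pderiv (cpoly A)) z = 0)" for z :: complex
    proof
      assume *: "poly (cpoly A) z = 0 \<and> poly (pderiv (cpoly A)) z = 0"
      then obtain x where "z = of_real x"
        using realA[of z] * by (auto elim: Reals_cases)
      then show False
        using * WA[of x] by (simp add: pderiv_cpoly poly_cpoly_of_real)
    qed
    then show ?thesis
      using realA by (simp add: simple_real_roots_iff rsquarefree_roots)
  qed
  have unique: "\<exists>!c. a < c \<and> c < b \<and> poly B c = 0"
    if W: "\<And>x. poly A x * poly (pderiv B) x \<noteq> poly (pderiv A) x * poly B x"
      and W': "\<And>x. poly B x * poly (pderiv A) x \<noteq> poly (pderiv B) x * poly A x"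
      and ab: "consecutive_roots A a b" for A B a b
  proof (rule ex_ex1I)
    show "\<exists>c. a < c \<and> c < b \<and> poly B c = 0"
      using ab poly_root_between_of_Wronskian_nonzero[OF W]
      by (simp add: consecutive_roots_def)
    have no_two: False if cd: "a < c" "c < d" "d < b" "poly B c = 0" "poly B d = 0" for c d
    proof -
      obtain e where "c < e" "e < d" "poly A e = 0"
        using poly_root_between_of_Wronskian_nonzero[OF W'] cd by blast
      then show False
        using ab cd by (auto simp: consecutive_roots_def)
    qed
    show "c = d" if "a < c \<and> c < b \<and> poly B c = 0" "a < d \<and> d < b \<and> poly B d = 0" for c d
      using no_two[of c d] no_two[of d c] that by (metis linorder_neqE)
  qed
  have "\<not> (poly (cpoly P) z = 0 \<and> poly (cpoly Q) z = 0)" for z :: complex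
  proof
    assume *: "poly (cpoly P) z = 0 \<and> poly (cpoly Q) z = 0"
    then obtain x where "z = of_real x"
      using real(1)[of z] * by (auto elim: Reals_cases)
    then show False
      using * W[of x] by (simp add: poly_cpoly_of_real)
  qed
  then show ?thesis
    unfolding simple_real_interlacing_roots_def
    using simple[OF real(1) W] simple[OF real(2) W'] unique[OF W W'] unique[OF W' W] by blast
qed

text \<open>
Both conclusions come from the factorization of \<open>G = P + \<i> Q\<close> into linear factors: the modulus of
the factors gives the inequality off the real axis, their logarithmic derivative the Wronskian on it.
\<close>

lemma interlacing_of_roots_upper_half_plane:
  assumes deg: "degree P > 0 \<or> degree Q > 0"
    and upper: "\<And>z. poly (cpoly P) z + \<i> * poly (cpoly Q) z = 0 \<Longrightarrow> Im z > 0"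
  shows "simple_real_interlacing_roots P Q"
    and "Im z < 0 \<Longrightarrow> Im (poly (cpoly P) z * cnj (poly (cpoly Q) z)) > 0"
proof -
  define G where "G = cpoly P + smult \<i> (cpoly Q)"
  define A where "A = proots G"
  define M where "M = (\<Prod>r\<in>#A. [:-r, 1:])"
  have G: "poly G z = poly (cpoly P) z + \<i> * poly (cpoly Q) z" for z
    by (simp add: G_def)
  have GM: "G = smult (lead_coeff G) M"
    unfolding M_def A_def by (rule complex_poly_decompose_multiset[symmetric])
  have degG: "degree G > 0"
  proof (rule ccontr)
    assume "\<not> degree G > 0"
    then have "coeff G n = 0" if "n > 0" for n
      using that by (simp add: coeff_eq_0)
    then have "coeff P n = 0 \<and> coeff Q n = 0" if "n > 0" for n
      using that by (force simp: G_def coeff_map_poly complex_eq_iff)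
    then show False
      using deg by (metis degree_0 leading_coeff_0_iff less_irrefl)
  qed
  then have "G \<noteq> 0"
    by auto
  then have lc: "lead_coeff G \<noteq> 0"
    by simp
  have "A \<noteq> {#}"
    using degG size_proots_complex[of G] by (auto simp: A_def)
  have A: "\<forall>r\<in>#A. Im r > 0"
    using \<open>G \<noteq> 0\<close> upper by (auto simp: A_def G)
  have lower: "Im (poly (cpoly P) z * cnj (poly (cpoly Q) z)) > 0" if "Im z < 0" for z
  proof -
    have "cmod (poly G (cnj z)) < cmod (poly G z)"
      using cmod_linear_factors_reflect[OF A that \<open>A \<noteq> {#}\<close>] lc
      by (subst (1 2) GM) (simp add: norm_mult M_def)
    moreover have "poly G (cnj z) = cnj (poly (cpoly P) z - \<i> * poly (cpoly Q) z)"
      by (simp add: G poly_cpoly_cnj)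
    ultimately have "cmod (poly (cpoly P) z - \<i> * poly (cpoly Q) z)
        < cmod (poly (cpoly P) z + \<i> * poly (cpoly Q) z)"
      by (simp only: complex_mod_cnj G)
    then have "(cmod (poly (cpoly P) z - \<i> * poly (cpoly Q) z))\<^sup>2
        < (cmod (poly (cpoly P) z + \<i> * poly (cpoly Q) z))\<^sup>2"
      by (intro power_strict_mono) auto
    then show ?thesis
      using Im_mult_cnj_eq[of "poly (cpoly P) z" "poly (cpoly Q) z"] by linarith
  qed
  then show "Im z < 0 \<Longrightarrow> Im (poly (cpoly P) z * cnj (poly (cpoly Q) z)) > 0" .
  have real: "z \<in> \<real>" if "poly (cpoly P) z = 0 \<or> poly (cpoly Q) z = 0" for z :: complex
  proof (rule ccontr)
    assume "z \<notin> \<real>"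
    \<comment> \<open>Non-real roots of real polynomials come in conjugate pairs, one of them in the lower half plane.\<close>
    then have "Im z < 0 \<or> Im (cnj z) < 0"
      by (auto simp: complex_is_Real_iff)
    then show False
      using lower[of z] lower[of "cnj z"] that by (auto simp: poly_cpoly_cnj)
  qed
  have W: "poly P x * poly (pderiv Q) x \<noteq> poly (pderiv P) x * poly Q x" for x
  proof -
    define k where "k = lead_coeff G"
    have "Im (poly (pderiv M) (of_real x) * cnj (poly M (of_real x))) > 0"
      unfolding M_def using A \<open>A \<noteq> {#}\<close> by (rule Im_pderiv_linear_factors_pos)
    then have "(cmod k)\<^sup>2 * Im (poly (pderiv M) (of_real x) * cnj (poly M (of_real x))) > 0"
      using lc by (simp add: k_def)
    also have "(cmod k)\<^sup>2 * Im (poly (pderiv M) (of_real x) * cnj (poly M (of_real x)))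
        = Im (poly (pderiv G) (of_real x) * cnj (poly G (of_real x)))"
      by (subst (1 2) GM)
        (simp add: pderiv_smult k_def[symmetric] cmod_power2, algebra)
    also have "\<dots> = poly P x * poly (pderiv Q) x - poly (pderiv P) x * poly Q x"
      by (simp add: G_def pderiv_add pderiv_smult pderiv_cpoly poly_cpoly_of_real)
    finally show ?thesis by simp
  qed
  show "simple_real_interlacing_roots P Q"
    using real W by (intro interlacing_of_Wronskian_nonzero) auto
qed

text \<open>
One point \<open>w\<close> fixes the constant sign of \<open>Im (P cnj Q)\<close> on the lower half plane, and a positive sign
means \<open>\<bar>P + \<i> Q\<bar> > \<bar>P - \<i> Q\<bar> \<ge> 0\<close> there.
\<close>

lemma roots_upper_half_plane_of_interlacing:
  assumes PQ: "simple_real_interlacing_roots P Q"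
    and w: "Im w < 0" "Im (poly (cpoly P) w * cnj (poly (cpoly Q) w)) > 0"
    and root: "poly (cpoly P) z + \<i> * poly (cpoly Q) z = 0"
  shows "Im z > 0"
proof (rule ccontr)
  \<comment> \<open>For real constants \<open>P\<close> and \<open>Q\<close> the imaginary part at \<open>w\<close> would be zero.\<close>
  have "degree P > 0 \<or> degree Q > 0"
  proof (rule ccontr)
    assume "\<not> (degree P > 0 \<or> degree Q > 0)"
    then obtain a b where "P = [:a:]" "Q = [:b:]"
      by (auto elim!: degree_eq_zeroE)
    then show False
      using w by (simp add: map_poly_pCons)
  qed
  then have lower: "Im (poly (cpoly P) z * cnj (poly (cpoly Q) z)) > 0" if "Im z < 0" for z
    using Im_quotient_constant_sign[OF PQ] w that by (meson less_asym)
  assume "\<not> Im z > 0"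
  then consider "Im z < 0" | "Im z = 0"
    by linarith
  then show False
  proof cases
    case 1
    then show False
      using lower[of z] Im_mult_cnj_eq[of "poly (cpoly P) z" "poly (cpoly Q) z"]
        zero_le_power2[of "cmod (poly (cpoly P) z - \<i> * poly (cpoly Q) z)"]
      unfolding root by simp
  next
    case 2
    then obtain x where x: "z = of_real x"
      by (metis complex_is_Real_iff Reals_cases)
    then have "poly P x = 0" "poly Q x = 0"
      using root unfolding x poly_cpoly_of_real by (auto simp: complex_eq_iff)
    then show False
      using no_common_real_root[OF PQ] by blast
  qed
qed

theorem theorem1:
  fixes f p q :: "real poly"
  assumes f_eq: "f = p \<circ>\<^sub>p monom 1 2 + monom 1 1 * (q \<circ>\<^sub>p monom 1 2)"
    and not_nonzero_const: "\<nexists>c. c \<noteq> 0 \<and> f = [:c:]"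
  shows "stable_poly (cpoly f) \<longleftrightarrow>
    simple_real_interlacing_roots (p \<circ>\<^sub>p (- monom 1 2)) (monom 1 1 * (q \<circ>\<^sub>p (- monom 1 2))) \<and>
    (\<exists>z0. Re z0 > 0 \<and> Re (poly (cpoly p) (z0\<^sup>2) / (z0 * poly (cpoly q) (z0\<^sup>2))) > 0)"
proof -
  define P where "P = p \<circ>\<^sub>p (- monom 1 2)"
  define Q where "Q = monom 1 1 * (q \<circ>\<^sub>p (- monom 1 2))"
  have minus_sq: "poly (cpoly (- monom 1 2)) z = - z\<^sup>2" for z
    by (simp add: minus_monom map_poly_monom poly_monom)
  have P: "poly (cpoly P) z = poly (cpoly p) (- z\<^sup>2)" for z
    unfolding P_def poly_cpoly_pcompose minus_sq ..
  have Q: "poly (cpoly Q) z = z * poly (cpoly q) (- z\<^sup>2)" for z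
    unfolding Q_def poly_cpoly_mult poly_cpoly_pcompose minus_sq
    by (simp add: map_poly_monom poly_monom)
  have f: "poly (cpoly f) z = poly (cpoly p) (z\<^sup>2) + z * poly (cpoly q) (z\<^sup>2)" for z
    unfolding f_eq poly_cpoly_add poly_cpoly_mult poly_cpoly_pcompose
    by (simp add: map_poly_monom poly_monom)
  have f_rot: "poly (cpoly f) (\<i> * z) = poly (cpoly P) z + \<i> * poly (cpoly Q) z" for z
    by (simp add: f P Q power_mult_distrib)
  have stable: "stable_poly (cpoly f) \<longleftrightarrow>
      (\<forall>z. poly (cpoly P) z + \<i> * poly (cpoly Q) z = 0 \<longrightarrow> Im z > 0)"
  proof -
    have "stable_poly (cpoly f) \<longleftrightarrow> (\<forall>z. poly (cpoly f) (\<i> * z) = 0 \<longrightarrow> Re (\<i> * z) < 0)"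
      unfolding stable_poly_def
      by (metis complex_i_not_zero nonzero_mult_div_cancel_left times_divide_eq_right)
    then show ?thesis
      by (simp add: f_rot)
  qed
  \<comment> \<open>Here \<open>z q(z\<^sup>2) = \<i> Q(-\<i> z)\<close>, and dividing by \<open>\<i>\<close> exchanges real and imaginary parts.\<close>
  have point: "Re (poly (cpoly p) (z\<^sup>2) / (z * poly (cpoly q) (z\<^sup>2))) > 0 \<longleftrightarrow>
      Im (poly (cpoly P) (-\<i> * z) * cnj (poly (cpoly Q) (-\<i> * z))) > 0" for z
  proof -
    have *: "Re (a / b) > 0 \<longleftrightarrow> Re (a * cnj b) > 0" for a b :: complex
      by (cases "b = 0") (simp_all add: complex_div_cnj[of a b] zero_less_divide_iff)
    have "poly (cpoly P) (-\<i> * z) = poly (cpoly p) (z\<^sup>2)"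
      "poly (cpoly Q) (-\<i> * z) = - \<i> * (z * poly (cpoly q) (z\<^sup>2))"
      unfolding P Q by (simp_all add: power_mult_distrib)
    then show ?thesis
      unfolding * by (simp add: algebra_simps)
  qed
  have ex_point: "(\<exists>z0. Re z0 > 0 \<and> Re (poly (cpoly p) (z0\<^sup>2) / (z0 * poly (cpoly q) (z0\<^sup>2))) > 0)
      \<longleftrightarrow> (\<exists>w. Im w < 0 \<and> Im (poly (cpoly P) w * cnj (poly (cpoly Q) w)) > 0)"
    (is "?L \<longleftrightarrow> ?R")
  proof
    assume ?L
    then obtain z where "Re z > 0" "Im (poly (cpoly P) (-\<i> * z) * cnj (poly (cpoly Q) (-\<i> * z))) > 0"
      unfolding point by blast
    then show ?R
      by (intro exI[of _ "-\<i> * z"]) auto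
  next
    assume ?R
    then obtain w where w: "Im w < 0" "Im (poly (cpoly P) w * cnj (poly (cpoly Q) w)) > 0"
      by blast
    have "-\<i> * (\<i> * w) = w"
      by simp
    with w show ?L
      unfolding point by (intro exI[of _ "\<i> * w"]) (simp only:, simp)
  qed
  \<comment> \<open>Constant \<open>P\<close> and \<open>Q\<close> make \<open>f\<close> constant, hence zero, and then \<open>G\<close> vanishes everywhere.\<close>
  have nonconst: "degree P > 0 \<or> degree Q > 0"
    if upper: "\<forall>z. poly (cpoly P) z + \<i> * poly (cpoly Q) z = 0 \<longrightarrow> Im z > 0"
  proof (rule ccontr)
    assume "\<not> (degree P > 0 \<or> degree Q > 0)"
    then obtain a b where ab: "P = [:a:]" "Q = [:b:]"
      by (auto elim!: degree_eq_zeroE)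
    then have "b = 0"
      using Q[of 0] by (simp add: map_poly_pCons)
    have "poly f x = a" for x
    proof -
      have "poly (cpoly f) (of_real x) = of_real a"
        using f_rot[of "- \<i> * x"] by (simp add: ab \<open>b = 0\<close> map_poly_pCons)
      then show ?thesis
        by (simp add: poly_cpoly_of_real)
    qed
    then have "poly f = poly [:a:]"
      by auto
    then have "f = [:a:]"
      by (simp only: poly_eq_poly_eq_iff)
    then have "a = 0"
      using not_nonzero_const by auto
    then show False
      using upper[rule_format, of 0] by (simp add: ab \<open>b = 0\<close>)
  qed
  show ?thesis
    unfolding stable ex_point P_def[symmetric] Q_def[symmetric]
  proof
    assume upper: "\<forall>z. poly (cpoly P) z + \<i> * poly (cpoly Q) z = 0 \<longrightarrow> Im z > 0"
    have "simple_real_interlacing_roots P Q"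
      using interlacing_of_roots_upper_half_plane(1)[OF nonconst] upper by blast
    moreover have "Im (poly (cpoly P) (-\<i>) * cnj (poly (cpoly Q) (-\<i>))) > 0"
      using upper by (intro interlacing_of_roots_upper_half_plane(2)[OF nonconst]) auto
    ultimately show "simple_real_interlacing_roots P Q \<and>
        (\<exists>w. Im w < 0 \<and> Im (poly (cpoly P) w * cnj (poly (cpoly Q) w)) > 0)"
      by (metis complex.sel(2) imaginary_unit.sel(2) neg_less_0_iff_less uminus_complex.sel(2) zero_less_one)
  next
    assume "simple_real_interlacing_roots P Q \<and>
      (\<exists>w. Im w < 0 \<and> Im (poly (cpoly P) w * cnj (poly (cpoly Q) w)) > 0)"
    then show "\<forall>z. poly (cpoly P) z + \<i> * poly (cpoly Q) z = 0 \<longrightarrow> Im z > 0"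
      using roots_upper_half_plane_of_interlacing by blast
  qed
qed

end
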